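(* Let $m\ge1$, $\mathbf N=(N_1,\dots,N_m)$ with every $N_\nu\ge3$, and $\mathbb T_{\mathbf N}=\prod_{\nu=1}^m\mathbb Z/N_\nu\mathbb Z$. Let $c_{x,\nu}>0$ ($x\in\mathbb T_{\mathbf N}$, $1\le\nu\le m$), $p=(p_1,\dots,p_m)\in\mathbb R^m$ and $V:\mathbb T_{\mathbf N}\to\mathbb R$. Let $\Lambda_p^c(V)$ be the principal eigenvalue of the operator $$(\mathcal L^{c}_{p,V}u)(x)=\sum_{\nu=1}^m\Bigl[c_{x,\nu}e^{-p_\nu}u(x+e_\nu)+c_{x-e_\nu,\nu}e^{p_\nu}u(x-e_\nu)-\bigl(c_{x,\nu}+c_{x-e_\nu,\nu}\bigr)u(x)\Bigr]+V(x)u(x)$$ on $\mathbb R^{\mathbb T_{\mathbf N}}$. Then $$\Lambda_p^c(V)=\max_{a\in\mathcal P_{\mathbf N}}\left\{-\sum_{x,\nu}c_{x,\nu}(a_{x+e_\nu}-a_x)^2+\sum_xV(x)a_x^2+\mathcal E_p^c(a)\right\},$$ where $$\mathcal E_p^c(a):=\min_{\beta\in\mathcal Z_{\mathbf N}}2\sum_{x,\nu}c_{x,\nu}a_xa_{x+e_\nu}\left[\cosh(\beta_{x+e_\nu}-\beta_x-p_\nu)-1\right].$$ In particular, $\mathcal E_0^c(a)=0$ for all $a\in\mathcal P_{\mathbf N}$, and for $p=0$ the formula reduces to the ordinary Rayleigh formula $$\Lambda_0^c(V)=\max_{a\in\mathcal P_{\mathbf N}}\left\{-\sum_{x,\nu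}c_{x,\nu}(a_{x+e_\nu}-a_x)^2+\sum_xV(x)a_x^2\right\}.$$
   Context: Here $e_\nu$ is the $\nu$-th standard unit vector and site arithmetic is periodic (modulo $N_\nu$ in coordinate $\nu$). Sums $\sum_{x,\nu}$ run over $x\in\mathbb T_{\mathbf N}$ and $1\le\nu\le m$. $\mathcal P_{\mathbf N}:=\{a:\mathbb T_{\mathbf N}\to(0,\infty):\sum_xa_x^2=1\}$ and $\mathcal Z_{\mathbf N}:=\{\beta:\mathbb T_{\mathbf N}\to\mathbb R:\sum_x\beta_x=0\}$. The matrix of $\mathcal L^c_{p,V}$ is irreducible and Metzler (nonnegative off-diagonal entries); its principal eigenvalue is its spectral bound (largest real part of an eigenvalue), a real, algebraically simple eigenvalue with a positive eigenvector. *)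

theory Defs
  imports Complex_Main "HOL-Library.FuncSet"
begin

text \<open>A site of the torus is an extensional function on the directions \<open>{1..m}\<close>; the residue class
  in \<open>\<int>/N \<nu>\<int>\<close> is represented by its member in \<open>{0..<N \<nu>}\<close>.\<close>

type_synonym site = "nat \<Rightarrow> int"

definition torus :: "nat \<Rightarrow> (nat \<Rightarrow> nat) \<Rightarrow> site set" where
  "torus m N = (\<Pi>\<^sub>E \<nu>\<in>{1..m}. {0..<int (N \<nu>)})"

text \<open>\<open>shift N \<nu> k x\<close> is the site \<open>x + k e\<^sub>\<nu>\<close>.\<close>

definition shift :: "(nat \<Rightarrow> nat) \<Rightarrow> nat \<Rightarrow> int \<Rightarrow> site \<Rightarrow> site" where
  "shift N \<nu> k x = x(\<nu> := (x \<nu> + k) mod int (N \<nu>))"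

definition hop_op ::
  "nat \<Rightarrow> (nat \<Rightarrow> nat) \<Rightarrow> (site \<Rightarrow> nat \<Rightarrow> real) \<Rightarrow> (nat \<Rightarrow> real) \<Rightarrow> (site \<Rightarrow> real)
    \<Rightarrow> (site \<Rightarrow> real) \<Rightarrow> (site \<Rightarrow> real)" where
  "hop_op m N c p V u = (\<lambda>x\<in>torus m N.
     (\<Sum>\<nu>=1..m.
        c x \<nu> * exp (- p \<nu>) * u (shift N \<nu> 1 x)
        + c (shift N \<nu> (-1) x) \<nu> * exp (p \<nu>) * u (shift N \<nu> (-1) x)
        - (c x \<nu> + c (shift N \<nu> (-1) x) \<nu>) * u x)
     + V x * u x)"

definition op_matrix :: "'a set \<Rightarrow> (('a \<Rightarrow> real) \<Rightarrow> ('a \<Rightarrow> real)) \<Rightarrow> 'a \<Rightarrow> 'a \<Rightarrow> real" where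
  "op_matrix S A x y = A (\<lambda>z\<in>S. if z = y then 1 else 0) x"

definition matrix_eigenvalues :: "'a set \<Rightarrow> ('a \<Rightarrow> 'a \<Rightarrow> real) \<Rightarrow> complex set" where
  "matrix_eigenvalues S M =
     {\<mu>. \<exists>w :: 'a \<Rightarrow> complex. (\<exists>x\<in>S. w x \<noteq> 0) \<and>
          (\<forall>x\<in>S. (\<Sum>y\<in>S. complex_of_real (M x y) * w y) = \<mu> * w x)}"

text \<open>For finite nonempty \<open>S\<close> the set of eigenvalues is finite and nonempty, so \<open>Max\<close> is meaningful.\<close>

definition spectral_bound :: "'a set \<Rightarrow> ('a \<Rightarrow> 'a \<Rightarrow> real) \<Rightarrow> real" where
  "spectral_bound S M = Max (Re ` matrix_eigenvalues S M)"

definition principal_eigenvalue ::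
  "nat \<Rightarrow> (nat \<Rightarrow> nat) \<Rightarrow> (site \<Rightarrow> nat \<Rightarrow> real) \<Rightarrow> (nat \<Rightarrow> real) \<Rightarrow> (site \<Rightarrow> real) \<Rightarrow> real" where
  "principal_eigenvalue m N c p V =
     spectral_bound (torus m N) (op_matrix (torus m N) (hop_op m N c p V))"

definition amplitudes :: "nat \<Rightarrow> (nat \<Rightarrow> nat) \<Rightarrow> (site \<Rightarrow> real) set" where
  "amplitudes m N = {a \<in> torus m N \<rightarrow>\<^sub>E {0<..}. (\<Sum>x\<in>torus m N. (a x)\<^sup>2) = 1}"

definition zero_sum_fields :: "nat \<Rightarrow> (nat \<Rightarrow> nat) \<Rightarrow> (site \<Rightarrow> real) set" where
  "zero_sum_fields m N = {\<beta> \<in> torus m N \<rightarrow>\<^sub>E UNIV. (\<Sum>x\<in>torus m N. \<beta> x) = 0}"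

definition dirichlet_form ::
  "nat \<Rightarrow> (nat \<Rightarrow> nat) \<Rightarrow> (site \<Rightarrow> nat \<Rightarrow> real) \<Rightarrow> (site \<Rightarrow> real) \<Rightarrow> real" where
  "dirichlet_form m N c a =
     (\<Sum>x\<in>torus m N. \<Sum>\<nu>=1..m. c x \<nu> * (a (shift N \<nu> 1 x) - a x)\<^sup>2)"

definition tilt_cost ::
  "nat \<Rightarrow> (nat \<Rightarrow> nat) \<Rightarrow> (site \<Rightarrow> nat \<Rightarrow> real) \<Rightarrow> (nat \<Rightarrow> real) \<Rightarrow> (site \<Rightarrow> real) \<Rightarrow> (site \<Rightarrow> real) \<Rightarrow> real"
  where
  "tilt_cost m N c p a \<beta> =
     2 * (\<Sum>x\<in>torus m N. \<Sum>\<nu>=1..m.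
       c x \<nu> * a x * a (shift N \<nu> 1 x) * (cosh (\<beta> (shift N \<nu> 1 x) - \<beta> x - p \<nu>) - 1))"

text \<open>\<open>Min\<close> and \<open>Max\<close> are restricted to finite sets, so the minimum over fields is an infimum here;
  that it is attained has to be asserted separately, with \<open>is_minimum\<close>.\<close>

definition min_cost ::
  "nat \<Rightarrow> (nat \<Rightarrow> nat) \<Rightarrow> (site \<Rightarrow> nat \<Rightarrow> real) \<Rightarrow> (nat \<Rightarrow> real) \<Rightarrow> (site \<Rightarrow> real) \<Rightarrow> real" where
  "min_cost m N c p a = (INF \<beta>\<in>zero_sum_fields m N. tilt_cost m N c p a \<beta>)"

definition is_minimum :: "real \<Rightarrow> real set \<Rightarrow> bool" where
  "is_minimum v S \<longleftrightarrow> v \<in> S \<and> (\<forall>y\<in>S. v \<le> y)"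

definition is_maximum :: "real \<Rightarrow> real set \<Rightarrow> bool" where
  "is_maximum v S \<longleftrightarrow> v \<in> S \<and> (\<forall>y\<in>S. y \<le> v)"

end

theory Submission
  imports Defs "HOL-Analysis.Function_Topology" "Jordan_Normal_Form.Spectral_Radius"
begin

text \<open>Writing \<open>w = a e\<^sup>\<beta>\<close> turns the bracket, before minimizing over \<open>\<beta>\<close>, into the
  Donsker--Varadhan functional \<open>\<Sum>x. a x\<^sup>2 (L w) x / w x\<close>. Choosing \<open>w\<close> as the right Perron eigenvector \<open>u\<close>
  gives exactly the principal eigenvalue for every \<open>a\<close>, hence the upper bound. With \<open>v\<close> the left Perron
  eigenvector and \<open>a\<^sup>2\<close> proportional to \<open>u v\<close>, the inequality \<open>exp t \<ge> 1 + t\<close> bounds the functional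
  from below by the same eigenvalue for every \<open>w\<close>. The minimum over \<open>\<beta>\<close> is attained because bounded cost
  bounds each increment of \<open>\<beta>\<close> along an edge, and the torus is connected.\<close>

section \<open>Perron--Frobenius theory by maximizing Collatz--Wielandt values\<close>

text \<open>Tychonoff: extensional functions are the points of the full product whose factors
  outside \<open>S\<close> are the singleton \<open>{undefined}\<close>, and every factor is
  compact.\<close>

lemma compact_PiE_Icc:
  fixes a b :: real
  shows "compact (S \<rightarrow>\<^sub>E {a..b} :: ('a \<Rightarrow> real) set)"
proof -
  have eq: "(S \<rightarrow>\<^sub>E {a..b}) = PiE UNIV (\<lambda>x. if x \<in> S then {a..b} else {undefined})"
    by (auto simp: PiE_def Pi_def extensional_def split: if_splits)
  have "compactin (product_topology (\<lambda>_. euclidean) UNIV)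
          (PiE UNIV (\<lambda>x. if x \<in> S then {a..b} else {undefined :: real}))"
    unfolding compactin_PiE by auto
  then show ?thesis
    unfolding eq euclidean_product_topology by simp
qed

definition super_eigen :: "'a set \<Rightarrow> ('a \<Rightarrow> 'a \<Rightarrow> real) \<Rightarrow> real \<Rightarrow> ('a \<Rightarrow> real) \<Rightarrow> bool" where
  "super_eigen S M \<mu> u \<longleftrightarrow> (\<forall>x\<in>S. u x \<ge> 0) \<and> (\<exists>x\<in>S. u x > 0) \<and>
     (\<forall>x\<in>S. \<mu> * u x \<le> (\<Sum>y\<in>S. M x y * u y))"

text \<open>The condition is homogeneous, so the vector may be divided by its sum. This replaces
  nonvanishing, which is not closed, by the closed condition that the sum is 1.\<close>

lemma super_eigen_normalize:
  assumes "finite S" and "super_eigen S M \<mu> u"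
  obtains v where "v \<in> S \<rightarrow>\<^sub>E {0..1}" "sum v S = 1" "super_eigen S M \<mu> v"
proof -
  define s where "s = sum u S"
  have nn: "\<And>x. x \<in> S \<Longrightarrow> u x \<ge> 0" using assms(2) by (auto simp: super_eigen_def)
  have s: "s > 0"
    using assms unfolding s_def super_eigen_def by (auto intro: sum_pos2)
  have le: "u x \<le> s" if "x \<in> S" for x
    unfolding s_def using that nn assms(1) by (intro member_le_sum) auto
  define v where "v = (\<lambda>x\<in>S. u x / s)"
  have "v \<in> S \<rightarrow>\<^sub>E {0..1}"
    using nn le s by (auto simp: v_def)
  moreover have "sum v S = 1"
    using s by (simp add: v_def sum_divide_distrib[symmetric] s_def)
  moreover have "super_eigen S M \<mu> v"
    unfolding super_eigen_def
  proof (intro conjI ballI)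
    fix x assume x: "x \<in> S"
    show "0 \<le> v x" using nn[OF x] s x by (simp add: v_def)
    have "\<mu> * u x / s \<le> (\<Sum>y\<in>S. M x y * u y) / s"
      using assms(2) x s by (auto simp: super_eigen_def intro!: divide_right_mono)
    then show "\<mu> * v x \<le> (\<Sum>y\<in>S. M x y * v y)"
      using x by (simp add: v_def sum_divide_distrib)
  next
    obtain x where "x \<in> S" "u x > 0" using assms(2) by (auto simp: super_eigen_def)
    then have "v x > 0" using s by (simp add: v_def)
    then show "\<exists>x\<in>S. 0 < v x" using \<open>x \<in> S\<close> by blast
  qed
  ultimately show ?thesis by (rule that)
qed

text \<open>Pairs of a bounded value and a normalized vector form a compact set, on which the
  projection to the value attains its maximum.\<close>

lemma exists_maximal_super_eigen:
  fixes M :: "'a \<Rightarrow> 'a \<Rightarrow> real"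
  assumes fin: "finite S" and ne: "S \<noteq> {}"
  obtains \<rho> u where "super_eigen S M \<rho> u"
    "\<And>\<mu> v. super_eigen S M \<mu> v \<Longrightarrow> \<mu> \<le> \<rho>"
proof -
  \<comment> \<open>Summing the inequalities of a normalized vector bounds its value by
    \<open>B\<close>. The constant vector shows that \<open>-B\<close> is admissible, so values
    below \<open>-B\<close> cannot compete.\<close>
  define B where "B = (\<Sum>x\<in>S. \<Sum>y\<in>S. \<bar>M x y\<bar>)"
  have row: "(\<Sum>y\<in>S. \<bar>M x y\<bar>) \<le> B" if "x \<in> S" for x
    unfolding B_def using that fin
    by (intro member_le_sum[where f = "\<lambda>x. \<Sum>y\<in>S. \<bar>M x y\<bar>"]) (auto intro: sum_nonneg)
  define K where "K = {z :: real \<times> ('a \<Rightarrow> real). z \<in> {-B..B} \<times> (S \<rightarrow>\<^sub>E {0..1}) \<and>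
     (\<Sum>x\<in>S. snd z x) = 1 \<and> (\<forall>x\<in>S. fst z * snd z x \<le> (\<Sum>y\<in>S. M x y * snd z y))}"
  have cont: "continuous_on UNIV (\<lambda>z :: real \<times> ('a \<Rightarrow> real). snd z x)" for x
    by (rule continuous_on_product_then_coordinatewise[OF continuous_on_snd[OF continuous_on_id]])
  have "K = (({-B..B} \<times> (S \<rightarrow>\<^sub>E {0..1})) \<inter> {z. (\<Sum>x\<in>S. snd z x) = 1}) \<inter>
      (\<Inter>x\<in>S. {z. fst z * snd z x \<le> (\<Sum>y\<in>S. M x y * snd z y)})"
    unfolding K_def by auto
  moreover have "compact (({-B..B} \<times> (S \<rightarrow>\<^sub>E {0..1})) \<inter>
      {z :: real \<times> ('a \<Rightarrow> real). (\<Sum>x\<in>S. snd z x) = 1})"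
    by (intro compact_Int_closed compact_Times compact_PiE_Icc compact_Icc closed_Collect_eq
        continuous_intros cont)
  moreover have "closed (\<Inter>x\<in>S. {z :: real \<times> ('a \<Rightarrow> real).
      fst z * snd z x \<le> (\<Sum>y\<in>S. M x y * snd z y)})"
    by (intro closed_INT ballI closed_Collect_le continuous_intros cont)
  ultimately have comp: "compact K" by (simp add: compact_Int_closed)
  have sup_iff: "super_eigen S M \<mu> v" if "(\<mu>, v) \<in> K" for \<mu> v
  proof -
    have "\<exists>x\<in>S. v x > 0"
    proof (rule ccontr)
      assume "\<not> ?thesis"
      then have "sum v S \<le> 0" by (intro sum_nonpos) (auto simp: not_less)
      then show False using that by (simp add: K_def)
    qed
    then show ?thesis using that by (auto simp: K_def super_eigen_def PiE_iff)
  qed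
  have inK: "(\<mu>, v) \<in> K"
    if v: "v \<in> S \<rightarrow>\<^sub>E {0..1}" "sum v S = 1" "super_eigen S M \<mu> v" and "-B \<le> \<mu>" for \<mu> v
  proof -
    have "\<mu> = (\<Sum>x\<in>S. \<mu> * v x)" using v by (simp add: sum_distrib_left[symmetric])
    also have "\<dots> \<le> (\<Sum>x\<in>S. \<Sum>y\<in>S. M x y * v y)"
      using v by (intro sum_mono) (auto simp: super_eigen_def)
    also have "\<dots> \<le> B"
      unfolding B_def
    proof (intro sum_mono)
      fix x y assume "x \<in> S" "y \<in> S"
      then have "0 \<le> v y" "v y \<le> 1" using v by (auto simp: PiE_iff)
      then have "M x y * v y \<le> \<bar>M x y\<bar> * v y" "\<bar>M x y\<bar> * v y \<le> \<bar>M x y\<bar> * 1"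
        by (simp_all only: mult_right_mono mult_left_mono abs_ge_self abs_ge_zero)
      then show "M x y * v y \<le> \<bar>M x y\<bar>" by simp
    qed
    finally show ?thesis using v \<open>-B \<le> \<mu>\<close> by (auto simp: K_def super_eigen_def)
  qed
  have "super_eigen S M (-B) (\<lambda>_. 1)"
    unfolding super_eigen_def
  proof (intro conjI ballI)
    fix x assume "x \<in> S"
    have "- (\<Sum>y\<in>S. M x y) \<le> (\<Sum>y\<in>S. \<bar>M x y\<bar>)"
      unfolding sum_negf[symmetric] by (intro sum_mono) auto
    then show "-B * 1 \<le> (\<Sum>y\<in>S. M x y * 1)" using row[OF \<open>x \<in> S\<close>] by simp
  qed (use ne in auto)
  then obtain v0 where "(-B, v0) \<in> K"
    using super_eigen_normalize[OF fin] inK by (metis order_refl)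
  then obtain z where z: "z \<in> K" "\<forall>w\<in>K. fst w \<le> fst z"
    using continuous_attains_sup[OF comp _ continuous_on_fst[OF continuous_on_id]]
    by (metis (no_types, lifting) empty_iff)
  show ?thesis
  proof (rule that[of "fst z" "snd z"])
    show "super_eigen S M (fst z) (snd z)" using sup_iff z by simp
    fix \<mu> v assume "super_eigen S M \<mu> v"
    then obtain w where w: "w \<in> S \<rightarrow>\<^sub>E {0..1}" "sum w S = 1" "super_eigen S M \<mu> w"
      by (rule super_eigen_normalize[OF fin])
    show "\<mu> \<le> fst z"
    proof (cases "-B \<le> \<mu>")
      case True
      then show ?thesis using inK[OF w] z by force
    next
      case False
      then show ?thesis using z(1) by (auto simp: K_def)
    qed
  qed
qed

lemma sum_mult_fun_upd_add:
  fixes M :: "'a \<Rightarrow> real"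
  assumes "finite S" "y \<in> S"
  shows "(\<Sum>w\<in>S. M w * (u(y := u y + e)) w) = (\<Sum>w\<in>S. M w * u w) + M y * e"
proof -
  have "(\<Sum>w\<in>S. M w * (u(y := u y + e)) w) = (\<Sum>w\<in>S. M w * u w + (if w = y then M y * e else 0))"
    by (intro sum.cong) (auto simp: algebra_simps)
  then show ?thesis using assms by (simp add: sum.distrib)
qed

text \<open>Among the vectors attaining the largest Collatz--Wielandt value, one with the most strict
  inequalities has none: otherwise increasing it slightly at a strict site makes an
  adjacent non-strict site strict.\<close>

lemma perron_frobenius:
  fixes M :: "'a \<Rightarrow> 'a \<Rightarrow> real"
  assumes fin: "finite S" and ne: "S \<noteq> {}"
    and metzler: "\<And>x y. x \<in> S \<Longrightarrow> y \<in> S \<Longrightarrow> x \<noteq> y \<Longrightarrow> M x y \<ge> 0"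
    and irred: "\<And>D. D \<subseteq> S \<Longrightarrow> D \<noteq> {} \<Longrightarrow> D \<noteq> S \<Longrightarrow> \<exists>x\<in>S - D. \<exists>y\<in>D. M x y > 0"
  shows "\<exists>\<rho> u. (\<forall>x\<in>S. u x > 0) \<and> (\<forall>x\<in>S. (\<Sum>y\<in>S. M x y * u y) = \<rho> * u x)"
proof -
  obtain \<rho> u0 where u0: "super_eigen S M \<rho> u0"
    and top: "\<And>\<mu> v. super_eigen S M \<mu> v \<Longrightarrow> \<mu> \<le> \<rho>"
    using exists_maximal_super_eigen[OF fin ne, of M] by blast
  define gap where "gap u x = (\<Sum>y\<in>S. M x y * u y) - \<rho> * u x" for u x
  define strict where "strict u = {x \<in> S. gap u x > 0}" for u
  have "card (strict u) < Suc (card S)" for u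
    using card_mono[OF fin, of "strict u"] by (auto simp: strict_def)
  then obtain u where u: "super_eigen S M \<rho> u"
    and most: "\<And>v. super_eigen S M \<rho> v \<Longrightarrow> card (strict v) \<le> card (strict u)"
    using ex_has_greatest_nat[of "super_eigen S M \<rho>" u0 "\<lambda>u. card (strict u)" "Suc (card S)"] u0
    by (metis less_imp_le)
  have gap0: "gap u x \<ge> 0" if "x \<in> S" for x
    using u that by (auto simp: super_eigen_def gap_def)
  have nn: "u x \<ge> 0" if "x \<in> S" for x
    using u that by (auto simp: super_eigen_def)
  have "strict u \<noteq> S"
  proof
    assume all: "strict u = S"
    \<comment> \<open>If every inequality were strict, \<open>\<rho>\<close> could be raised by this
      \<open>e\<close>. The \<open>+ 1\<close> keeps the denominator positive where \<open>u\<close>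
      vanishes.\<close>
    define e where "e = Min ((\<lambda>x. gap u x / (u x + 1)) ` S)"
    have "e > 0"
      unfolding e_def using all nn fin ne
      by (subst Min_gr_iff) (auto simp: strict_def intro!: divide_pos_pos add_nonneg_pos)
    have "super_eigen S M (\<rho> + e) u"
      unfolding super_eigen_def
    proof (intro conjI ballI)
      fix x assume x: "x \<in> S"
      have "e \<le> gap u x / (u x + 1)" unfolding e_def using x fin by (intro Min_le) auto
      then have "e * (u x + 1) \<le> gap u x" using nn[OF x] by (simp add: pos_le_divide_eq)
      then show "(\<rho> + e) * u x \<le> (\<Sum>y\<in>S. M x y * u y)"
        using \<open>e > 0\<close> by (simp add: gap_def algebra_simps)
    qed (use u in \<open>auto simp: super_eigen_def\<close>)
    from top[OF this] \<open>e > 0\<close> show False by simp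
  qed
  moreover have "strict u = {}" if "strict u \<noteq> S"
  proof (rule ccontr)
    assume "strict u \<noteq> {}"
    with irred[of "strict u"] that obtain x y
      where x: "x \<in> S" "x \<notin> strict u" and y: "y \<in> strict u" and Mxy: "M x y > 0"
      by (auto simp: strict_def)
    have yS: "y \<in> S" and gy: "gap u y > 0" and xy: "x \<noteq> y" using y x by (auto simp: strict_def)
    \<comment> \<open>The update changes the gap at \<open>y\<close> by
      \<open>e * (M y y - \<rho>)\<close>, so this choice leaves it at least \<open>e\<close>
      there.\<close>
    define e where "e = gap u y / (1 + \<bar>M y y - \<rho>\<bar>)"
    have e: "e > 0" using gy by (simp add: e_def add_pos_nonneg)
    define v where "v = u(y := u y + e)"
    have Mv: "(\<Sum>w\<in>S. M z w * v w) = (\<Sum>w\<in>S. M z w * u w) + M z y * e" for z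
      unfolding v_def by (rule sum_mult_fun_upd_add[OF fin yS])
    have gz: "gap v z = gap u z + M z y * e" if "z \<noteq> y" for z
      using that Mv[of z] by (simp add: gap_def v_def)
    have "e * (1 + \<bar>M y y - \<rho>\<bar>) = gap u y"
      unfolding e_def by (simp add: add_pos_nonneg less_imp_neq[symmetric])
    moreover have "e * - \<bar>M y y - \<rho>\<bar> \<le> e * (M y y - \<rho>)"
      using e by (intro mult_left_mono) auto
    ultimately have gv: "gap v y > 0"
      using e Mv[of y] by (simp add: gap_def v_def algebra_simps)
    \<comment> \<open>Away from \<open>y\<close> the update only adds an off-diagonal entry times
      \<open>e\<close>, so no strict inequality is lost; at \<open>x\<close> one is gained.\<close>
    have gez: "gap v z \<ge> gap u z" if "z \<in> S" "z \<noteq> y" for z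
      using gz[OF that(2)] metzler[OF that(1) yS that(2)] e by simp
    have "super_eigen S M \<rho> v"
      unfolding super_eigen_def
    proof (intro conjI ballI)
      fix z assume z: "z \<in> S"
      show "0 \<le> v z" using nn[OF z] nn[OF yS] e by (auto simp: v_def)
      have "gap v z \<ge> 0"
        using gv gez[OF z] gap0[OF z] by (cases "z = y") auto
      then show "\<rho> * v z \<le> (\<Sum>y\<in>S. M z y * v y)" by (simp add: gap_def)
    next
      show "\<exists>x\<in>S. 0 < v x" using yS nn[OF yS] e by (auto simp: v_def intro!: bexI[of _ y])
    qed
    moreover have "insert x (strict u) \<subseteq> strict v"
    proof -
      have "gap v x > 0" using gz[OF xy] gap0[OF x(1)] Mxy e by (simp add: add_nonneg_pos)
      moreover have "gap v z > 0" if "z \<in> strict u" for z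
        using gv gez[of z] that by (cases "z = y") (auto simp: strict_def)
      ultimately show ?thesis using x by (auto simp: strict_def)
    qed
    then have "card (insert x (strict u)) \<le> card (strict v)"
      using fin by (intro card_mono) (auto simp: strict_def)
    moreover have "finite (strict u)" using fin by (auto simp: strict_def)
    ultimately show False using most[of v] x by simp
  qed
  ultimately have "gap u x = 0" if "x \<in> S" for x
    using gap0[OF that] that by (force simp: strict_def)
  then have eig: "(\<Sum>y\<in>S. M x y * u y) = \<rho> * u x" if "x \<in> S" for x
    using that by (simp add: gap_def)
  \<comment> \<open>If the support of \<open>u\<close> were proper, irreducibility would give a zero
    of \<open>u\<close> with a positive entry into the support; the eigenvalue equation there would
    equate a positive sum with 0.\<close>
  define D where "D = {x \<in> S. u x > 0}"
  have "D = S"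
  proof (rule ccontr)
    assume "D \<noteq> S"
    moreover have "D \<noteq> {}" using u by (auto simp: D_def super_eigen_def)
    ultimately obtain x y where x: "x \<in> S" "x \<notin> D" and y: "y \<in> D" and Mxy: "M x y > 0"
      using irred[of D] by (auto simp: D_def)
    have ux: "u x = 0" using x nn[of x] by (auto simp: D_def)
    have "0 < (\<Sum>y\<in>S. M x y * u y)"
    proof (rule sum_pos2[OF fin])
      show "y \<in> S" "0 < M x y * u y" using y Mxy by (auto simp: D_def)
      fix z assume "z \<in> S"
      then show "0 \<le> M x z * u z"
        using metzler[of x z] nn[of z] x ux by (cases "z = x") auto
    qed
    then show False using eig[OF x(1)] ux by simp
  qed
  then have pos: "u x > 0" if "x \<in> S" for x using that by (auto simp: D_def)
  from pos eig show ?thesis by blast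
qed

text \<open>The previous result is applied to \<open>M\<close> and to its transpose. Evaluating the
  pairing of \<open>v\<close> with \<open>M u\<close> in both ways shows that the two eigenvalues
  agree, since the pairing of \<open>v\<close> with \<open>u\<close> is positive.\<close>

lemma left_right_perron:
  fixes M :: "'a \<Rightarrow> 'a \<Rightarrow> real"
  assumes fin: "finite S" and ne: "S \<noteq> {}"
    and metzler: "\<And>x y. x \<in> S \<Longrightarrow> y \<in> S \<Longrightarrow> x \<noteq> y \<Longrightarrow> M x y \<ge> 0"
    and irred: "\<And>D. D \<subseteq> S \<Longrightarrow> D \<noteq> {} \<Longrightarrow> D \<noteq> S \<Longrightarrow> \<exists>x\<in>S - D. \<exists>y\<in>D. M x y > 0"
  shows "\<exists>\<rho> u v. (\<forall>x\<in>S. u x > 0) \<and> (\<forall>x\<in>S. v x > 0) \<and>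
    (\<forall>x\<in>S. (\<Sum>y\<in>S. M x y * u y) = \<rho> * u x) \<and>
    (\<forall>y\<in>S. (\<Sum>x\<in>S. v x * M x y) = \<rho> * v y)"
proof -
  obtain \<rho> u where u: "\<And>x. x \<in> S \<Longrightarrow> u x > 0"
    "\<And>x. x \<in> S \<Longrightarrow> (\<Sum>y\<in>S. M x y * u y) = \<rho> * u x"
    using perron_frobenius[OF fin ne metzler irred] by blast
  \<comment> \<open>Transposing reverses the direction in which a cut is crossed, which amounts to
    exchanging \<open>D\<close> with its complement.\<close>
  have irred': "\<exists>x\<in>S - D. \<exists>y\<in>D. M y x > 0" if "D \<subseteq> S" "D \<noteq> {}" "D \<noteq> S" for D
    using irred[of "S - D"] that by blast
  have metzler': "M y x \<ge> 0" if "x \<in> S" "y \<in> S" "x \<noteq> y" for x y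
    using metzler that by blast
  obtain \<mu> v where v: "\<And>x. x \<in> S \<Longrightarrow> v x > 0"
    "\<And>x. x \<in> S \<Longrightarrow> (\<Sum>y\<in>S. M y x * v y) = \<mu> * v x"
    using perron_frobenius[of S "\<lambda>x y. M y x", OF fin ne metzler' irred'] by blast
  have pos: "(\<Sum>x\<in>S. v x * u x) > 0" using fin ne u(1) v(1) by (intro sum_pos) auto
  have "\<rho> * (\<Sum>x\<in>S. v x * u x) = (\<Sum>x\<in>S. v x * (\<Sum>y\<in>S. M x y * u y))"
    unfolding sum_distrib_left[of \<rho>] using u(2) by (intro sum.cong) auto
  also have "\<dots> = (\<Sum>y\<in>S. u y * (\<Sum>x\<in>S. M x y * v x))"
    unfolding sum_distrib_left by (subst sum.swap) (auto intro!: sum.cong)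
  also have "\<dots> = \<mu> * (\<Sum>x\<in>S. v x * u x)"
    unfolding sum_distrib_left[of \<mu>] using v(2) by (intro sum.cong) auto
  finally have "\<rho> = \<mu>" using pos by simp
  with u v show ?thesis
    by (intro exI[of _ \<rho>] exI[of _ u] exI[of _ v]) (auto simp: mult.commute)
qed

section \<open>The spectral bound and the Donsker--Varadhan inequality\<close>

text \<open>An enumeration of \<open>S\<close> maps the eigenvalues into the spectrum of a square
  complex matrix. Finiteness gives \<open>Max\<close> in the spectral bound its meaning.\<close>

lemma finite_matrix_eigenvalues:
  assumes "finite S"
  shows "finite (matrix_eigenvalues S M)"
proof -
  define n where "n = card S"
  obtain h where h: "bij_betw h {0..<n} S"
    using ex_bij_betw_nat_finite[OF assms] by (auto simp: n_def)
  define A where "A = mat n n (\<lambda>(i, j). complex_of_real (M (h i) (h j)))"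
  have A: "A \<in> carrier_mat n n" by (simp add: A_def)
  have "matrix_eigenvalues S M \<subseteq> spectrum A"
  proof
    fix \<mu> assume "\<mu> \<in> matrix_eigenvalues S M"
    then obtain w x where x: "x \<in> S" "w x \<noteq> 0"
      and w: "\<And>x. x \<in> S \<Longrightarrow> (\<Sum>y\<in>S. complex_of_real (M x y) * w y) = \<mu> * w x"
      by (auto simp: matrix_eigenvalues_def)
    define v where "v = vec n (\<lambda>i. w (h i))"
    obtain i where i: "i < n" "h i = x"
      using h x by (auto simp: bij_betw_def)
    then have "v $ i \<noteq> 0" using x by (simp add: v_def)
    then have "v \<noteq> 0\<^sub>v n" using i by auto
    moreover have "A *\<^sub>v v = \<mu> \<cdot>\<^sub>v v"
    proof (rule eq_vecI)
      fix i assume "i < dim_vec (\<mu> \<cdot>\<^sub>v v)"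
      then have i: "i < n" by (simp add: v_def)
      have "(A *\<^sub>v v) $ i = (\<Sum>j = 0..<n. complex_of_real (M (h i) (h j)) * w (h j))"
        using i by (simp add: A_def v_def scalar_prod_def)
      also have "\<dots> = (\<Sum>y\<in>S. complex_of_real (M (h i) y) * w y)"
        by (rule sum.reindex_bij_betw[OF h])
      also have "\<dots> = \<mu> * w (h i)"
        using w bij_betwE[OF h] i by auto
      finally show "(A *\<^sub>v v) $ i = (\<mu> \<cdot>\<^sub>v v) $ i"
        using i by (simp add: v_def)
    qed (simp add: A_def v_def)
    ultimately have "eigenvector A v \<mu>"
      using A by (auto simp: eigenvector_def v_def)
    then show "\<mu> \<in> spectrum A"
      by (auto simp: spectrum_def eigenvalue_def)
  qed
  then show ?thesis using card_finite_spectrum(1)[OF A] by (rule finite_subset)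
qed

text \<open>The moduli of a complex eigenvector satisfy the Collatz--Wielandt inequality with the
  real part of its eigenvalue. Pairing with the positive left eigenvector compares that real part
  with \<open>\<rho>\<close>.\<close>

lemma spectral_bound_eq_perron:
  fixes M :: "'a \<Rightarrow> 'a \<Rightarrow> real"
  assumes fin: "finite S" and ne: "S \<noteq> {}"
    and metzler: "\<And>x y. x \<in> S \<Longrightarrow> y \<in> S \<Longrightarrow> x \<noteq> y \<Longrightarrow> M x y \<ge> 0"
    and u: "\<And>x. x \<in> S \<Longrightarrow> u x > 0" "\<And>x. x \<in> S \<Longrightarrow> (\<Sum>y\<in>S. M x y * u y) = \<rho> * u x"
    and v: "\<And>x. x \<in> S \<Longrightarrow> v x > 0" "\<And>y. y \<in> S \<Longrightarrow> (\<Sum>x\<in>S. v x * M x y) = \<rho> * v y"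
  shows "spectral_bound S M = \<rho>"
  unfolding spectral_bound_def
proof (rule Max_eqI)
  show "finite (Re ` matrix_eigenvalues S M)"
    using finite_matrix_eigenvalues[OF fin] by simp
  have "complex_of_real \<rho> \<in> matrix_eigenvalues S M"
    unfolding matrix_eigenvalues_def
  proof (intro CollectI exI[of _ "\<lambda>x. complex_of_real (u x)"] conjI ballI)
    show "\<exists>x\<in>S. complex_of_real (u x) \<noteq> 0" using ne u(1) by force
    fix x assume "x \<in> S"
    from arg_cong[OF u(2)[OF this], of complex_of_real]
    show "(\<Sum>y\<in>S. complex_of_real (M x y) * complex_of_real (u y)) =
        complex_of_real \<rho> * complex_of_real (u x)" by simp
  qed
  then show "\<rho> \<in> Re ` matrix_eigenvalues S M" by force
next
  fix r assume "r \<in> Re ` matrix_eigenvalues S M"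
  then obtain \<mu> w x0 where r: "r = Re \<mu>" and x0: "x0 \<in> S" "w x0 \<noteq> 0"
    and w: "\<And>x. x \<in> S \<Longrightarrow> (\<Sum>y\<in>S. complex_of_real (M x y) * w y) = \<mu> * w x"
    by (auto simp: matrix_eigenvalues_def)
  have ineq: "r * cmod (w x) \<le> (\<Sum>y\<in>S. M x y * cmod (w y))" if x: "x \<in> S" for x
  proof -
    \<comment> \<open>The diagonal entry may have either sign, so it is moved to the left before the
      triangle inequality is applied.\<close>
    have "(\<mu> - M x x) * w x = (\<Sum>y\<in>S - {x}. complex_of_real (M x y) * w y)"
      using w[OF x] sum.remove[OF fin x, of "\<lambda>y. complex_of_real (M x y) * w y"]
      by (simp add: algebra_simps)
    then have "cmod (\<mu> - M x x) * cmod (w x) = cmod (\<Sum>y\<in>S - {x}. complex_of_real (M x y) * w y)"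
      by (metis norm_mult)
    also have "\<dots> \<le> (\<Sum>y\<in>S - {x}. M x y * cmod (w y))"
      using metzler x by (intro sum_norm_le) (auto simp: norm_mult)
    finally have "cmod (\<mu> - M x x) * cmod (w x) \<le> (\<Sum>y\<in>S - {x}. M x y * cmod (w y))" .
    moreover have "(r - M x x) * cmod (w x) \<le> cmod (\<mu> - M x x) * cmod (w x)"
      using complex_Re_le_cmod[of "\<mu> - M x x"] by (intro mult_right_mono) (auto simp: r)
    ultimately show ?thesis
      using sum.remove[OF fin x, of "\<lambda>y. M x y * cmod (w y)"] by (simp add: algebra_simps)
  qed
  have "r * (\<Sum>x\<in>S. v x * cmod (w x)) = (\<Sum>x\<in>S. v x * (r * cmod (w x)))"
    by (simp add: sum_distrib_left algebra_simps)
  also have "\<dots> \<le> (\<Sum>x\<in>S. v x * (\<Sum>y\<in>S. M x y * cmod (w y)))"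
    using ineq v(1) by (intro sum_mono mult_left_mono) (auto simp: less_imp_le)
  also have "\<dots> = (\<Sum>y\<in>S. cmod (w y) * (\<Sum>x\<in>S. v x * M x y))"
    unfolding sum_distrib_left by (subst sum.swap) (auto intro!: sum.cong)
  also have "\<dots> = \<rho> * (\<Sum>x\<in>S. v x * cmod (w x))"
    unfolding sum_distrib_left[of \<rho>] using v(2) by (intro sum.cong) (auto simp: algebra_simps)
  finally have "r * (\<Sum>x\<in>S. v x * cmod (w x)) \<le> \<rho> * (\<Sum>x\<in>S. v x * cmod (w x))" .
  moreover have "(\<Sum>x\<in>S. v x * cmod (w x)) > 0"
    using fin x0 v(1) by (intro sum_pos2[of _ x0]) (auto simp: less_imp_le)
  ultimately show "r \<le> \<rho>" by simp
qed

text \<open>With \<open>w = u e\<^sup>h\<close> each term is \<open>v x * M x y * u y * exp (h y - h x)\<close>; the bound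
  \<open>exp t \<ge> 1 + t\<close> leaves the total unchanged, because both marginals of \<open>v x * M x y * u y\<close> are
  \<open>\<rho> * v x * u x\<close>.\<close>

lemma donsker_varadhan_lower:
  fixes M :: "'a \<Rightarrow> 'a \<Rightarrow> real"
  assumes metzler: "\<And>x y. x \<in> S \<Longrightarrow> y \<in> S \<Longrightarrow> x \<noteq> y \<Longrightarrow> M x y \<ge> 0"
    and u: "\<And>x. x \<in> S \<Longrightarrow> u x > 0" "\<And>x. x \<in> S \<Longrightarrow> (\<Sum>y\<in>S. M x y * u y) = \<rho> * u x"
    and v: "\<And>x. x \<in> S \<Longrightarrow> v x > 0" "\<And>y. y \<in> S \<Longrightarrow> (\<Sum>x\<in>S. v x * M x y) = \<rho> * v y"
    and w: "\<And>x. x \<in> S \<Longrightarrow> w x > 0"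
  shows "\<rho> * (\<Sum>x\<in>S. u x * v x) \<le> (\<Sum>x\<in>S. u x * v x * ((\<Sum>y\<in>S. M x y * w y) / w x))"
proof -
  define h where "h x = ln (w x / u x)" for x
  have wh: "w x = u x * exp (h x)" if "x \<in> S" for x
    using u(1)[OF that] w[OF that] by (simp add: h_def)
  have "(\<Sum>x\<in>S. \<Sum>y\<in>S. v x * M x y * u y * (h y - h x)) =
     (\<Sum>x\<in>S. \<Sum>y\<in>S. v x * M x y * u y * h y) - (\<Sum>x\<in>S. \<Sum>y\<in>S. v x * M x y * u y * h x)"
    by (simp add: sum_subtractf right_diff_distrib)
  also have "(\<Sum>x\<in>S. \<Sum>y\<in>S. v x * M x y * u y * h y) = (\<Sum>y\<in>S. (\<Sum>x\<in>S. v x * M x y) * (u y * h y))"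
    unfolding sum_distrib_right by (subst sum.swap) (simp add: mult.assoc)
  also have "\<dots> = (\<Sum>x\<in>S. \<rho> * v x * u x * h x)"
    using v(2) by (intro sum.cong) auto
  also have "(\<Sum>x\<in>S. \<Sum>y\<in>S. v x * M x y * u y * h x) = (\<Sum>x\<in>S. (\<Sum>y\<in>S. M x y * u y) * (v x * h x))"
    unfolding sum_distrib_right by (intro sum.cong) auto
  also have "\<dots> = (\<Sum>x\<in>S. \<rho> * v x * u x * h x)"
    using u(2) by (intro sum.cong) auto
  finally have zero: "(\<Sum>x\<in>S. \<Sum>y\<in>S. v x * M x y * u y * (h y - h x)) = 0" by simp
  have "\<rho> * (\<Sum>x\<in>S. u x * v x) = (\<Sum>x\<in>S. v x * (\<Sum>y\<in>S. M x y * u y))"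
    unfolding sum_distrib_left[of \<rho>] using u(2) by (intro sum.cong) auto
  also have "\<dots> = (\<Sum>x\<in>S. \<Sum>y\<in>S. v x * M x y * u y * (1 + (h y - h x)))"
    using zero by (simp add: sum_distrib_left distrib_left sum.distrib mult.assoc)
  also have "\<dots> \<le> (\<Sum>x\<in>S. \<Sum>y\<in>S. v x * M x y * u y * exp (h y - h x))"
  proof (intro sum_mono)
    fix x y assume xy: "x \<in> S" "y \<in> S"
    show "v x * M x y * u y * (1 + (h y - h x)) \<le> v x * M x y * u y * exp (h y - h x)"
    \<comment> \<open>On the diagonal, where the entry may be negative, the exponent is 0 and both
      sides agree.\<close>
    proof (cases "x = y")
      case False
      then show ?thesis
        using xy metzler[OF xy] u(1)[OF xy(2)] v(1)[OF xy(1)]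
        by (intro mult_left_mono exp_ge_add_one_self) auto
    qed simp
  qed
  also have "\<dots> = (\<Sum>x\<in>S. u x * v x * ((\<Sum>y\<in>S. M x y * w y) / w x))"
  proof (intro sum.cong refl)
    fix x assume x: "x \<in> S"
    have "u x * v x * ((\<Sum>y\<in>S. M x y * w y) / w x) = (\<Sum>y\<in>S. v x * (M x y * w y) / exp (h x))"
      using u(1)[OF x] wh[OF x] by (simp add: sum_distrib_left sum_divide_distrib)
    also have "\<dots> = (\<Sum>y\<in>S. v x * M x y * u y * exp (h y - h x))"
      using wh by (intro sum.cong) (auto simp: exp_diff)
    finally show "(\<Sum>y\<in>S. v x * M x y * u y * exp (h y - h x)) =
        u x * v x * ((\<Sum>y\<in>S. M x y * w y) / w x)" by simp
  qed
  finally show ?thesis .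
qed

text \<open>One of the two exponentials is at least \<open>1 + \<bar>t\<bar>\<close> and the other
  is positive. Linear growth of this kind is enough for coercivity of the cost.\<close>

lemma abs_le_cosh: "\<bar>t\<bar> \<le> 2 * cosh t - (1 :: real)"
proof -
  have "2 * cosh t = exp t + exp (- t)" by (simp add: cosh_field_def)
  then show ?thesis
    using exp_ge_add_one_self[of t] exp_ge_add_one_self[of "-t"] exp_gt_zero[of t] exp_gt_zero[of "-t"]
    by linarith
qed

section \<open>Shifts and connectedness of the torus\<close>

locale conductances =
  fixes m :: nat and N :: "nat \<Rightarrow> nat" and c :: "site \<Rightarrow> nat \<Rightarrow> real"
  assumes side: "\<And>\<nu>. \<nu> \<in> {1..m} \<Longrightarrow> N \<nu> \<ge> 2"
    and c_pos: "\<And>x \<nu>. x \<in> torus m N \<Longrightarrow> \<nu> \<in> {1..m} \<Longrightarrow> c x \<nu> > 0"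
begin

abbreviation "T \<equiv> torus m N"

lemma c_nonneg: "x \<in> T \<Longrightarrow> \<nu> \<in> {1..m} \<Longrightarrow> c x \<nu> \<ge> 0"
  using c_pos less_imp_le by blast

lemma finite_torus: "finite T"
  by (simp add: torus_def finite_PiE)

lemma torus_nonempty: "T \<noteq> {}"
  using side by (fastforce simp: torus_def PiE_eq_empty_iff)

lemma shift_in_torus: "x \<in> T \<Longrightarrow> \<nu> \<in> {1..m} \<Longrightarrow> shift N \<nu> k x \<in> T"
  using side[of \<nu>] by (auto simp: torus_def shift_def PiE_iff extensional_def)

lemma shift_0: "x \<in> T \<Longrightarrow> \<nu> \<in> {1..m} \<Longrightarrow> shift N \<nu> 0 x = x"
  by (auto simp: torus_def shift_def PiE_iff fun_eq_iff)

lemma shift_shift: "shift N \<nu> j (shift N \<nu> k x) = shift N \<nu> (j + k) x"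
  by (auto simp: shift_def fun_eq_iff mod_simps add_ac)

lemma shift_1_neq:
  assumes "x \<in> T" "\<nu> \<in> {1..m}"
  shows "shift N \<nu> 1 x \<noteq> x"
proof
  assume "shift N \<nu> 1 x = x"
  then have "(x \<nu> + 1) mod int (N \<nu>) = x \<nu>"
    by (metis shift_def fun_upd_same)
  moreover have "x \<nu> mod int (N \<nu>) = x \<nu>"
    using assms by (auto simp: torus_def PiE_iff)
  ultimately have "(x \<nu> + 1) mod int (N \<nu>) = x \<nu> mod int (N \<nu>)" by simp
  then have "int (N \<nu>) dvd 1" by (simp add: mod_eq_dvd_iff)
  then show False using side[OF assms(2)] by auto
qed

text \<open>The unit shift permutes the torus. This charges the backward hop at a site to the start
  of the forward edge ending there.\<close>

lemma sum_shift:
  assumes "\<nu> \<in> {1..m}"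
  shows "(\<Sum>x\<in>T. f x (shift N \<nu> (-1) x)) = (\<Sum>x\<in>T. f (shift N \<nu> 1 x) x)"
  by (rule sum.reindex_bij_witness[of _ "shift N \<nu> 1" "shift N \<nu> (-1)"])
    (use assms in \<open>auto simp: shift_in_torus shift_shift shift_0\<close>)

text \<open>Forward edges alone: by periodicity, walking on round a cycle also realizes backward
  moves.\<close>

definition steps :: "(site \<times> site) set" where
  "steps = {(x, shift N \<nu> 1 x) | x \<nu>. x \<in> T \<and> \<nu> \<in> {1..m}}"

lemma shift_reachable:
  assumes "x \<in> T" "\<nu> \<in> {1..m}"
  shows "(x, shift N \<nu> (int k) x) \<in> steps\<^sup>*"
proof (induction k)
  case 0
  then show ?case using assms by (simp add: shift_0)
next
  case (Suc k)
  have "(shift N \<nu> (int k) x, shift N \<nu> 1 (shift N \<nu> (int k) x)) \<in> steps"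
    using assms shift_in_torus by (auto simp: steps_def)
  then show ?case using Suc by (simp add: shift_shift rtrancl_into_rtrancl)
qed

text \<open>Coordinates are corrected one at a time: \<open>z j\<close> has the first
  \<open>j\<close> coordinates of \<open>y\<close> and the remaining ones of
  \<open>x\<close>.\<close>

lemma torus_connected:
  assumes x: "x \<in> T" and y: "y \<in> T"
  shows "(x, y) \<in> steps\<^sup>*"
proof -
  define z where "z j = (\<lambda>\<nu>. if \<nu> \<in> {1..j} then y \<nu> else x \<nu>)" for j
  have zT: "z j \<in> T" if "j \<le> m" for j
    using x y that by (auto simp: z_def torus_def PiE_iff extensional_def)
  have "(x, z j) \<in> steps\<^sup>*" if "j \<le> m" for j
    using that
  proof (induction j)
    case 0
    then show ?case by (simp add: z_def)
  next
    case (Suc j)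
    define \<nu> where "\<nu> = Suc j"
    have \<nu>: "\<nu> \<in> {1..m}" using Suc by (simp add: \<nu>_def)
    \<comment> \<open>The forward distance on the cycle: reduction modulo \<open>N \<nu>\<close>
      makes it nonnegative.\<close>
    define k where "k = nat ((y \<nu> - x \<nu>) mod int (N \<nu>))"
    have "int k = (y \<nu> - x \<nu>) mod int (N \<nu>)" using side[OF \<nu>] by (simp add: k_def)
    then have "(x \<nu> + int k) mod int (N \<nu>) = y \<nu>"
      using y \<nu> by (auto simp: mod_simps torus_def PiE_iff)
    then have "shift N \<nu> (int k) (z j) = z (Suc j)"
      by (auto simp: shift_def z_def fun_eq_iff \<nu>_def le_Suc_eq)
    then show ?case
      using shift_reachable[OF zT \<nu>, of j k] Suc by (auto intro: rtrancl_trans)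
  qed
  moreover have "z m = y"
    using x y by (auto simp: z_def torus_def PiE_iff extensional_def fun_eq_iff)
  ultimately show ?thesis by force
qed

text \<open>If no forward edge entered \<open>D\<close>, every path starting outside would stay
  outside, against connectedness.\<close>

lemma cut_crossed:
  assumes "D \<subseteq> T" "D \<noteq> {}" "D \<noteq> T"
  shows "\<exists>x\<in>T - D. \<exists>\<nu>\<in>{1..m}. shift N \<nu> 1 x \<in> D"
proof (rule ccontr)
  assume no: "\<not> ?thesis"
  obtain x y where x: "x \<in> T - D" and y: "y \<in> D" using assms by blast
  have "z \<in> T - D" if "(x, z) \<in> steps\<^sup>*" for z
    using that
  proof induction
    case base
    then show ?case using x by simp
  next
    case (step z w)
    then show ?case using no shift_in_torus by (auto simp: steps_def)
  qed
  then show False using torus_connected[of x y] x y assms by blast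
qed

section \<open>The hopping operator as an irreducible Metzler matrix\<close>

abbreviation "L p V \<equiv> op_matrix T (hop_op m N c p V)"

text \<open>Linearity: each term of the operator evaluates \<open>u\<close> at a single site, which
  a delta sum over the torus reproduces.\<close>

lemma hop_op_eq_sum:
  assumes x: "x \<in> T"
  shows "hop_op m N c p V u x = (\<Sum>y\<in>T. L p V x y * u y)"
proof -
  have delta: "(\<Sum>y\<in>T. k * (if z = y then 1 else 0) * u y) = k * u z" if "z \<in> T" for z k
  proof -
    have "(\<Sum>y\<in>T. k * (if z = y then 1 else 0) * u y) = (\<Sum>y\<in>T. if z = y then k * u y else 0)"
      by (intro sum.cong) auto
    then show ?thesis using that finite_torus by simp
  qed
  have "(\<Sum>y\<in>T. L p V x y * u y) =
     (\<Sum>y\<in>T. (\<Sum>\<nu>=1..m.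
        c x \<nu> * exp (- p \<nu>) * (if shift N \<nu> 1 x = y then 1 else 0) * u y
        + c (shift N \<nu> (-1) x) \<nu> * exp (p \<nu>) * (if shift N \<nu> (-1) x = y then 1 else 0) * u y
        - (c x \<nu> + c (shift N \<nu> (-1) x) \<nu>) * (if x = y then 1 else 0) * u y)
     + V x * (if x = y then 1 else 0) * u y)"
    using x by (intro sum.cong refl)
      (simp add: op_matrix_def hop_op_def shift_in_torus sum_distrib_right distrib_right
        left_diff_distrib)
  also have "\<dots> = hop_op m N c p V u x"
    unfolding sum.distrib using x
    by (subst sum.swap) (simp add: sum.distrib sum_subtractf delta shift_in_torus hop_op_def)
  finally show ?thesis by simp
qed

lemma op_matrix_off_diagonal:
  assumes "x \<in> T" "y \<in> T" "x \<noteq> y"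
  shows "L p V x y =
     (\<Sum>\<nu>=1..m. c x \<nu> * exp (- p \<nu>) * (if shift N \<nu> 1 x = y then 1 else 0)
        + c (shift N \<nu> (-1) x) \<nu> * exp (p \<nu>) * (if shift N \<nu> (-1) x = y then 1 else 0))"
  using assms by (simp add: op_matrix_def hop_op_def shift_in_torus)

lemma op_matrix_metzler:
  assumes "x \<in> T" "y \<in> T" "x \<noteq> y"
  shows "L p V x y \<ge> 0"
  unfolding op_matrix_off_diagonal[OF assms]
  using assms by (intro sum_nonneg add_nonneg_nonneg mult_nonneg_nonneg c_nonneg shift_in_torus) auto

lemma op_matrix_step_pos:
  assumes "x \<in> T" "\<nu> \<in> {1..m}"
  shows "L p V x (shift N \<nu> 1 x) > 0"
proof -
  have *: "x \<in> T" "shift N \<nu> 1 x \<in> T" "x \<noteq> shift N \<nu> 1 x"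
    using assms shift_in_torus shift_1_neq by metis+
  show ?thesis
    unfolding op_matrix_off_diagonal[OF *]
  proof (rule sum_pos2[of _ \<nu>])
    \<comment> \<open>The forward hop is positive by itself; the backward hop, if it reaches the
      same site, is nonnegative and cannot cancel it.\<close>
    have "0 \<le> c (shift N \<nu> (-1) x) \<nu>" "0 < c x \<nu>"
      using assms by (auto intro!: less_imp_le c_pos shift_in_torus)
    then show "0 < c x \<nu> * exp (- p \<nu>) * (if shift N \<nu> 1 x = shift N \<nu> 1 x then 1 else 0)
        + c (shift N \<nu> (-1) x) \<nu> * exp (p \<nu>) *
          (if shift N \<nu> (-1) x = shift N \<nu> 1 x then 1 else 0)"
      by (simp add: add_pos_nonneg)
  qed (use assms in \<open>auto intro!: add_nonneg_nonneg mult_nonneg_nonneg c_nonneg shift_in_torus\<close>)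
qed

lemma op_matrix_irreducible:
  assumes "D \<subseteq> T" "D \<noteq> {}" "D \<noteq> T"
  shows "\<exists>x\<in>T - D. \<exists>y\<in>D. L p V x y > 0"
  using cut_crossed[OF assms] op_matrix_step_pos by blast

text \<open>The abstract theory yields a common eigenvalue with positive left and right
  eigenvectors, and such an eigenvalue is the spectral bound.\<close>

lemma principal_eigenvectors:
  "\<exists>u v. (\<forall>x\<in>T. u x > 0) \<and> (\<forall>x\<in>T. v x > 0) \<and>
    (\<forall>x\<in>T. (\<Sum>y\<in>T. L p V x y * u y) = principal_eigenvalue m N c p V * u x) \<and>
    (\<forall>y\<in>T. (\<Sum>x\<in>T. v x * L p V x y) = principal_eigenvalue m N c p V * v y)"
proof -
  have "\<exists>\<rho> u v. (\<forall>x\<in>T. u x > 0) \<and> (\<forall>x\<in>T. v x > 0) \<and>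
    (\<forall>x\<in>T. (\<Sum>y\<in>T. L p V x y * u y) = \<rho> * u x) \<and>
    (\<forall>y\<in>T. (\<Sum>x\<in>T. v x * L p V x y) = \<rho> * v y)"
    by (rule left_right_perron[OF finite_torus torus_nonempty])
      (blast intro: op_matrix_metzler op_matrix_irreducible)+
  then obtain \<rho> u v where uv: "\<And>x. x \<in> T \<Longrightarrow> u x > 0" "\<And>x. x \<in> T \<Longrightarrow> v x > 0"
    "\<And>x. x \<in> T \<Longrightarrow> (\<Sum>y\<in>T. L p V x y * u y) = \<rho> * u x"
    "\<And>y. y \<in> T \<Longrightarrow> (\<Sum>x\<in>T. v x * L p V x y) = \<rho> * v y"
    by blast
  have "principal_eigenvalue m N c p V = \<rho>"
    unfolding principal_eigenvalue_def
    by (rule spectral_bound_eq_perron[OF finite_torus torus_nonempty op_matrix_metzler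
          uv(1,3) uv(2,4)])
  with uv show ?thesis by blast
qed

section \<open>The bracket as a Donsker--Varadhan functional\<close>

text \<open>The bracket of the variational formula at a fixed field, before minimization.\<close>

definition energy :: "(nat \<Rightarrow> real) \<Rightarrow> (site \<Rightarrow> real) \<Rightarrow> (site \<Rightarrow> real) \<Rightarrow> (site \<Rightarrow> real) \<Rightarrow> real" where
  "energy p V a \<beta> = - dirichlet_form m N c a + (\<Sum>x\<in>T. V x * (a x)\<^sup>2) + tilt_cost m N c p a \<beta>"

text \<open>Once backward hops are charged to the start of their edge, each edge carries both
  \<open>exp t\<close> and \<open>exp (- t)\<close>, hence a \<open>cosh\<close>, while the diagonal
  terms complete a square.\<close>

lemma energy_eq:
  assumes a: "\<And>x. x \<in> T \<Longrightarrow> a x > 0" and w: "\<And>x. x \<in> T \<Longrightarrow> w x = a x * exp (\<beta> x)"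
  shows "energy p V a \<beta> = (\<Sum>x\<in>T. (a x)\<^sup>2 * ((\<Sum>y\<in>T. L p V x y * w y) / w x))"
proof -
  let ?s = "\<lambda>\<nu> x. shift N \<nu> 1 x" and ?r = "\<lambda>\<nu> x. shift N \<nu> (-1) x"
  \<comment> \<open>\<open>F \<nu> x\<close> is the forward hop at \<open>x\<close>, and
    \<open>G \<nu> y x\<close> the backward hop at \<open>y\<close> along the edge from
    \<open>x\<close> to \<open>y\<close>, each with its share of the diagonal.\<close>
  define F where "F \<nu> x = c x \<nu> * a x * a (?s \<nu> x) * exp (\<beta> (?s \<nu> x) - \<beta> x - p \<nu>) - c x \<nu> * (a x)\<^sup>2"
    for \<nu> x
  define G where "G \<nu> y x = c x \<nu> * a x * a y * exp (- (\<beta> y - \<beta> x - p \<nu>)) - c x \<nu> * (a y)\<^sup>2"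
    for \<nu> y x
  have pt: "(a x)\<^sup>2 * ((\<Sum>y\<in>T. L p V x y * w y) / w x) =
      (\<Sum>\<nu>=1..m. F \<nu> x + G \<nu> x (?r \<nu> x)) + V x * (a x)\<^sup>2" if x: "x \<in> T" for x
  proof -
    have q: "(a x)\<^sup>2 * (k * w y / w x) = k * a x * a y * exp (\<beta> y - \<beta> x)" if "y \<in> T" for y k
      using a[OF x] w[OF x] w[OF that] by (simp add: exp_diff power2_eq_square)
    have qx: "(a x)\<^sup>2 * (k * w x / w x) = k * (a x)\<^sup>2" for k
      using a[OF x] w[OF x] by simp
    have summand: "(a x)\<^sup>2 * ((c x \<nu> * exp (- p \<nu>) * w (?s \<nu> x) + c (?r \<nu> x) \<nu> * exp (p \<nu>) * w (?r \<nu> x)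
        - (c x \<nu> + c (?r \<nu> x) \<nu>) * w x) / w x) = F \<nu> x + G \<nu> x (?r \<nu> x)" if \<nu>: "\<nu> \<in> {1..m}" for \<nu>
    proof -
      have "(a x)\<^sup>2 * ((c x \<nu> * exp (- p \<nu>) * w (?s \<nu> x) + c (?r \<nu> x) \<nu> * exp (p \<nu>) * w (?r \<nu> x)
        - (c x \<nu> + c (?r \<nu> x) \<nu>) * w x) / w x) =
        (a x)\<^sup>2 * (c x \<nu> * exp (- p \<nu>) * w (?s \<nu> x) / w x) +
        (a x)\<^sup>2 * (c (?r \<nu> x) \<nu> * exp (p \<nu>) * w (?r \<nu> x) / w x) -
        (a x)\<^sup>2 * ((c x \<nu> + c (?r \<nu> x) \<nu>) * w x / w x)"
        by (simp add: add_divide_distrib diff_divide_distrib distrib_left right_diff_distrib)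
      also have "\<dots> = c x \<nu> * exp (- p \<nu>) * a x * a (?s \<nu> x) * exp (\<beta> (?s \<nu> x) - \<beta> x) +
        c (?r \<nu> x) \<nu> * exp (p \<nu>) * a x * a (?r \<nu> x) * exp (\<beta> (?r \<nu> x) - \<beta> x) -
        (c x \<nu> + c (?r \<nu> x) \<nu>) * (a x)\<^sup>2"
        unfolding qx by (simp only: q[OF shift_in_torus[OF x \<nu>]])
      also have "\<dots> = F \<nu> x + G \<nu> x (?r \<nu> x)"
      proof -
        have "exp (\<beta> (?s \<nu> x) - \<beta> x - p \<nu>) = exp (- p \<nu>) * exp (\<beta> (?s \<nu> x) - \<beta> x)"
          "exp (- (\<beta> x - \<beta> (?r \<nu> x) - p \<nu>)) = exp (p \<nu>) * exp (\<beta> (?r \<nu> x) - \<beta> x)"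
          by (simp_all flip: exp_add)
        then show ?thesis by (simp add: F_def G_def algebra_simps)
      qed
      finally show ?thesis .
    qed
    have "(\<Sum>y\<in>T. L p V x y * w y) = (\<Sum>\<nu>=1..m. c x \<nu> * exp (- p \<nu>) * w (?s \<nu> x)
        + c (?r \<nu> x) \<nu> * exp (p \<nu>) * w (?r \<nu> x) - (c x \<nu> + c (?r \<nu> x) \<nu>) * w x) + V x * w x"
      using hop_op_eq_sum[OF x, of p V w] x by (simp add: hop_op_def)
    then show ?thesis
      using qx[of "V x"]
      by (simp only: add_divide_distrib[of "sum _ _"] sum_divide_distrib distrib_left[of "(a x)\<^sup>2"]
          sum_distrib_left summand cong: sum.cong)
  qed
  \<comment> \<open>The two diagonal shares equal minus the squared increment of \<open>a\<close>
    minus twice the product of its end values, both weighted by \<open>c\<close>; the product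
    supplies the \<open>- 1\<close> next to \<open>cosh\<close>.\<close>
  have edge: "F \<nu> x + G \<nu> (?s \<nu> x) x = - (c x \<nu> * (a (?s \<nu> x) - a x)\<^sup>2) +
      2 * (c x \<nu> * a x * a (?s \<nu> x) * (cosh (\<beta> (?s \<nu> x) - \<beta> x - p \<nu>) - 1))" for x \<nu>
    unfolding F_def G_def cosh_field_def by (simp add: field_simps power2_eq_square)
  have "(\<Sum>x\<in>T. \<Sum>\<nu>=1..m. F \<nu> x + G \<nu> x (?r \<nu> x)) = (\<Sum>x\<in>T. \<Sum>\<nu>=1..m. F \<nu> x + G \<nu> (?s \<nu> x) x)"
    by (subst (1 2) sum.swap) (auto simp: sum.distrib sum_shift intro!: sum.cong)
  also have "\<dots> = - dirichlet_form m N c a + tilt_cost m N c p a \<beta>"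
    by (simp add: edge dirichlet_form_def tilt_cost_def sum.distrib sum_subtractf sum_negf sum_distrib_left)
  finally have total: "(\<Sum>x\<in>T. \<Sum>\<nu>=1..m. F \<nu> x + G \<nu> x (?r \<nu> x)) =
    - dirichlet_form m N c a + tilt_cost m N c p a \<beta>" .
  have "(\<Sum>x\<in>T. (a x)\<^sup>2 * ((\<Sum>y\<in>T. L p V x y * w y) / w x)) =
      (\<Sum>x\<in>T. (\<Sum>\<nu>=1..m. F \<nu> x + G \<nu> x (?r \<nu> x)) + V x * (a x)\<^sup>2)"
    by (intro sum.cong refl pt)
  also have "\<dots> = (\<Sum>x\<in>T. \<Sum>\<nu>=1..m. F \<nu> x + G \<nu> x (?r \<nu> x)) + (\<Sum>x\<in>T. V x * (a x)\<^sup>2)"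
    by (rule sum.distrib)
  finally show ?thesis
    unfolding total energy_def by simp
qed

section \<open>Attainment of the minimum over the fields\<close>

lemma amplitude_pos: "a \<in> amplitudes m N \<Longrightarrow> x \<in> T \<Longrightarrow> a x > 0"
  by (auto simp: amplitudes_def PiE_iff)

lemma tilt_cost_term_nonneg:
  assumes "a \<in> amplitudes m N" "x \<in> T" "\<nu> \<in> {1..m}"
  shows "c x \<nu> * a x * a (shift N \<nu> 1 x) * (cosh (t :: real) - 1) \<ge> 0"
  using assms amplitude_pos[OF assms(1)] c_pos[OF assms(2,3)] shift_in_torus[OF assms(2,3)]
    cosh_real_ge_1[of t]
  by (intro mult_nonneg_nonneg) (auto intro: less_imp_le)

lemma tilt_cost_nonneg: "a \<in> amplitudes m N \<Longrightarrow> tilt_cost m N c p a \<beta> \<ge> 0"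
  unfolding tilt_cost_def
  by (intro mult_nonneg_nonneg sum_nonneg tilt_cost_term_nonneg) auto

text \<open>All edge terms are nonnegative, so the total cost bounds each one. Dividing by its
  positive weight bounds the \<open>cosh\<close>, hence the increment.\<close>

lemma tilt_cost_controls_increment:
  assumes a: "a \<in> amplitudes m N" and x: "x \<in> T" and \<nu>: "\<nu> \<in> {1..m}"
    and le: "tilt_cost m N c p a \<beta> \<le> C"
  shows "\<bar>\<beta> (shift N \<nu> 1 x) - \<beta> x\<bar> \<le> 1 + C / (c x \<nu> * a x * a (shift N \<nu> 1 x)) + \<bar>p \<nu>\<bar>"
proof -
  let ?t = "\<lambda>x \<nu>. \<beta> (shift N \<nu> 1 x) - \<beta> x - p \<nu>"
  let ?w = "\<lambda>x \<nu>. c x \<nu> * a x * a (shift N \<nu> 1 x)"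
  have w: "?w x \<nu> > 0"
    using amplitude_pos[OF a] c_pos[OF x \<nu>] shift_in_torus[OF x \<nu>] x by simp
  have "?w x \<nu> * (cosh (?t x \<nu>) - 1) \<le> (\<Sum>\<nu>=1..m. ?w x \<nu> * (cosh (?t x \<nu>) - 1))"
    using a x \<nu> tilt_cost_term_nonneg
    by (intro member_le_sum[where f = "\<lambda>\<nu>. ?w x \<nu> * (cosh (?t x \<nu>) - 1)"]) auto
  also have "\<dots> \<le> (\<Sum>x\<in>T. \<Sum>\<nu>=1..m. ?w x \<nu> * (cosh (?t x \<nu>) - 1))"
    using a x tilt_cost_term_nonneg finite_torus
    by (intro member_le_sum[where f = "\<lambda>x. \<Sum>\<nu>=1..m. ?w x \<nu> * (cosh (?t x \<nu>) - 1)"] sum_nonneg) auto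
  also have "2 * \<dots> \<le> C" using le by (simp add: tilt_cost_def)
  finally have "2 * (cosh (?t x \<nu>) - 1) * ?w x \<nu> \<le> C"
    by (simp only: mult_ac)
  then have "2 * (cosh (?t x \<nu>) - 1) \<le> C / ?w x \<nu>"
    by (simp only: pos_le_divide_eq[OF w])
  moreover have "\<bar>d\<bar> \<le> 1 + q + \<bar>b\<bar>" if "2 * (cosh (d - b) - 1) \<le> q" for d b q :: real
    using that abs_le_cosh[of "d - b"] abs_triangle_ineq2[of d b] by simp
  ultimately show ?thesis by blast
qed

text \<open>Increment bounds add up along paths, so connectedness bounds the oscillation of
  \<open>\<beta>\<close>; the zero sum then fixes the additive constant.\<close>

lemma tilt_cost_coercive:
  assumes a: "a \<in> amplitudes m N"
  obtains B where "\<And>\<beta> x. \<beta> \<in> zero_sum_fields m N \<Longrightarrow> tilt_cost m N c p a \<beta> \<le> C \<Longrightarrow> x \<in> T \<Longrightarrow> \<bar>\<beta> x\<bar> \<le> B"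
proof -
  have "\<exists>K. \<forall>\<beta>. tilt_cost m N c p a \<beta> \<le> C \<longrightarrow> \<bar>\<beta> y - \<beta> x\<bar> \<le> K" if "(x, y) \<in> steps\<^sup>*" for x y
    using that
  proof induction
    case base
    show ?case by (intro exI[of _ 0]) auto
  next
    case (step y z)
    then obtain \<nu> where \<nu>: "y \<in> T" "\<nu> \<in> {1..m}" "z = shift N \<nu> 1 y" by (auto simp: steps_def)
    obtain K where K: "\<And>\<beta>. tilt_cost m N c p a \<beta> \<le> C \<Longrightarrow> \<bar>\<beta> y - \<beta> x\<bar> \<le> K" using step by blast
    show ?case
      using tilt_cost_controls_increment[OF a \<nu>(1,2)] K unfolding \<nu>(3)
      by (intro exI[of _ "K + (1 + C / (c y \<nu> * a y * a (shift N \<nu> 1 y)) + \<bar>p \<nu>\<bar>)"]) fastforce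
  qed
  then have "\<exists>K. \<forall>\<beta>. tilt_cost m N c p a \<beta> \<le> C \<longrightarrow> \<bar>\<beta> y - \<beta> x\<bar> \<le> K" if "x \<in> T" "y \<in> T" for x y
    using torus_connected[OF that] by blast
  then obtain K where K: "\<And>x y \<beta>. x \<in> T \<Longrightarrow> y \<in> T \<Longrightarrow> tilt_cost m N c p a \<beta> \<le> C \<Longrightarrow> \<bar>\<beta> y - \<beta> x\<bar> \<le> K x y"
    by metis
  \<comment> \<open>Absolute values guard against a negative \<open>K x y\<close>, possible when no
    field meets the cost bound.\<close>
  define B where "B = (\<Sum>x\<in>T. \<Sum>y\<in>T. \<bar>K x y\<bar>)"
  have KB: "\<bar>\<beta> y - \<beta> x\<bar> \<le> B" if "x \<in> T" "y \<in> T" "tilt_cost m N c p a \<beta> \<le> C" for x y \<beta>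
  proof -
    have "\<bar>K x y\<bar> \<le> (\<Sum>y\<in>T. \<bar>K x y\<bar>)"
      using that finite_torus by (intro member_le_sum[where f = "\<lambda>y. \<bar>K x y\<bar>"]) auto
    also have "\<dots> \<le> B" unfolding B_def
      using that finite_torus
      by (intro member_le_sum[where f = "\<lambda>x. \<Sum>y\<in>T. \<bar>K x y\<bar>"]) (auto intro: sum_nonneg)
    finally show ?thesis using K[OF that] by linarith
  qed
  show ?thesis
  proof (rule that[of B])
    fix \<beta> x assume z: "\<beta> \<in> zero_sum_fields m N" and t: "tilt_cost m N c p a \<beta> \<le> C" and x: "x \<in> T"
    have s: "sum \<beta> T = 0" using z by (simp add: zero_sum_fields_def)
    \<comment> \<open>A zero-sum field has a value at most 0 and a value at least 0, so bounded
      oscillation bounds it from both sides.\<close>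
    obtain y where y: "y \<in> T" "\<beta> y \<le> 0"
      using sum_pos[OF finite_torus torus_nonempty, of \<beta>] s by (force simp: not_less[symmetric])
    obtain y' where y': "y' \<in> T" "\<beta> y' \<ge> 0"
      using sum_pos[OF finite_torus torus_nonempty, of "\<lambda>x. - \<beta> x"] s
      by (force simp: not_less[symmetric] sum_negf)
    show "\<bar>\<beta> x\<bar> \<le> B" using KB[OF y(1) x t] KB[OF y'(1) x t] y y' by linarith
  qed
qed

text \<open>By coercivity, the fields costing no more than the zero field lie in a compact box slice
  \<open>K\<close>. A minimizer on \<open>K\<close> is global, since every field outside costs more
  than the zero field.\<close>

lemma tilt_cost_attains_minimum:
  assumes a: "a \<in> amplitudes m N"
  obtains \<beta> where "\<beta> \<in> zero_sum_fields m N"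
    "\<And>\<gamma>. \<gamma> \<in> zero_sum_fields m N \<Longrightarrow> tilt_cost m N c p a \<beta> \<le> tilt_cost m N c p a \<gamma>"
proof -
  define \<beta>0 :: "site \<Rightarrow> real" where "\<beta>0 = (\<lambda>x\<in>T. 0)"
  have \<beta>0: "\<beta>0 \<in> zero_sum_fields m N" by (auto simp: \<beta>0_def zero_sum_fields_def)
  obtain B where B: "\<And>\<beta> x. \<beta> \<in> zero_sum_fields m N \<Longrightarrow>
      tilt_cost m N c p a \<beta> \<le> tilt_cost m N c p a \<beta>0 \<Longrightarrow> x \<in> T \<Longrightarrow> \<bar>\<beta> x\<bar> \<le> B"
    using tilt_cost_coercive[OF a] by metis
  define K where "K = (T \<rightarrow>\<^sub>E {-B..B}) \<inter> {\<beta>. (\<Sum>x\<in>T. \<beta> x) = 0}"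
  have low: "\<beta> \<in> K" if "\<beta> \<in> zero_sum_fields m N" "tilt_cost m N c p a \<beta> \<le> tilt_cost m N c p a \<beta>0" for \<beta>
    using that(1) B[OF that] by (fastforce simp: K_def zero_sum_fields_def PiE_iff abs_le_iff)
  have sub: "K \<subseteq> zero_sum_fields m N" by (auto simp: K_def zero_sum_fields_def PiE_iff)
  have "compact K"
    unfolding K_def
    by (intro compact_Int_closed compact_PiE_Icc closed_Collect_eq continuous_on_sum
        continuous_on_const continuous_on_product_coordinates)
  moreover have "K \<noteq> {}" using low[OF \<beta>0] by auto
  moreover have "continuous_on K (tilt_cost m N c p a)"
  proof -
    have [continuous_intros]: "continuous_on K (\<lambda>\<beta>. \<beta> x)" for x
      by (rule continuous_on_subset[OF continuous_on_product_coordinates]) simp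
    show ?thesis unfolding tilt_cost_def cosh_field_def by (intro continuous_intros) auto
  qed
  ultimately obtain \<beta> where \<beta>: "\<beta> \<in> K" "\<And>\<gamma>. \<gamma> \<in> K \<Longrightarrow> tilt_cost m N c p a \<beta> \<le> tilt_cost m N c p a \<gamma>"
    using continuous_attains_inf[of K "tilt_cost m N c p a"] by blast
  show ?thesis
  proof (rule that[of \<beta>])
    show "\<beta> \<in> zero_sum_fields m N" using \<beta> sub by blast
    fix \<gamma> assume "\<gamma> \<in> zero_sum_fields m N"
    then show "tilt_cost m N c p a \<beta> \<le> tilt_cost m N c p a \<gamma>"
      using low[of \<gamma>] \<beta>(2)[of \<gamma>] \<beta>(2)[OF low[OF \<beta>0]] by linarith
  qed
qed

lemma min_cost_is_minimum:
  assumes a: "a \<in> amplitudes m N"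
  shows "is_minimum (min_cost m N c p a) (tilt_cost m N c p a ` zero_sum_fields m N)"
proof -
  obtain \<beta> where \<beta>: "\<beta> \<in> zero_sum_fields m N"
    "\<And>\<gamma>. \<gamma> \<in> zero_sum_fields m N \<Longrightarrow> tilt_cost m N c p a \<beta> \<le> tilt_cost m N c p a \<gamma>"
    using tilt_cost_attains_minimum[OF a] by blast
  then have "min_cost m N c p a = tilt_cost m N c p a \<beta>"
    unfolding min_cost_def by (intro cInf_eq_minimum) auto
  then show ?thesis using \<beta> by (auto simp: is_minimum_def)
qed

text \<open>Without tilt the zero field costs nothing, because \<open>cosh 0 = 1\<close>, and no
  cost is negative.\<close>

lemma min_cost_zero_tilt:
  assumes a: "a \<in> amplitudes m N"
  shows "min_cost m N c (\<lambda>_. 0) a = 0"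
proof -
  have "(\<lambda>x\<in>T. 0) \<in> zero_sum_fields m N" by (auto simp: zero_sum_fields_def)
  moreover have "tilt_cost m N c (\<lambda>_. 0) a (\<lambda>x\<in>T. 0) = 0"
    by (simp add: tilt_cost_def shift_in_torus)
  ultimately have "min_cost m N c (\<lambda>_. 0) a \<le> 0"
    using min_cost_is_minimum[OF a, of "\<lambda>_. 0"] by (force simp: is_minimum_def)
  moreover have "min_cost m N c (\<lambda>_. 0) a \<ge> 0"
    using min_cost_is_minimum[OF a, of "\<lambda>_. 0"] tilt_cost_nonneg[OF a]
    by (auto simp: is_minimum_def)
  ultimately show ?thesis by simp
qed

section \<open>The two bounds and the variational formula\<close>

text \<open>The field is chosen so that \<open>a\<close> times its exponential is a multiple of the
  right eigenvector; all quotients then equal \<open>\<rho>\<close>, and the weights sum to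
  1.\<close>

lemma energy_eq_principal_eigenvalue:
  assumes a: "a \<in> amplitudes m N"
  shows "\<exists>\<beta>\<in>zero_sum_fields m N. energy p V a \<beta> = principal_eigenvalue m N c p V"
proof -
  define \<rho> where "\<rho> = principal_eigenvalue m N c p V"
  obtain u where u: "\<And>x. x \<in> T \<Longrightarrow> u x > 0"
    "\<And>x. x \<in> T \<Longrightarrow> (\<Sum>y\<in>T. L p V x y * u y) = \<rho> * u x"
    using principal_eigenvectors[of p V] unfolding \<rho>_def by blast
  \<comment> \<open>Subtracting the mean makes the field sum to 0; it only rescales
    \<open>w\<close>, which leaves the quotients unchanged.\<close>
  define k where "k = (\<Sum>x\<in>T. ln (u x / a x)) / card T"
  define \<beta> where "\<beta> = (\<lambda>x\<in>T. ln (u x / a x) - k)"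
  have \<beta>: "\<beta> \<in> zero_sum_fields m N"
    using finite_torus torus_nonempty
    by (simp add: zero_sum_fields_def \<beta>_def sum_subtractf k_def)
  define w where "w x = u x * exp (- k)" for x
  have "energy p V a \<beta> = (\<Sum>x\<in>T. (a x)\<^sup>2 * ((\<Sum>y\<in>T. L p V x y * w y) / w x))"
  proof (rule energy_eq)
    fix x assume x: "x \<in> T"
    show "a x > 0" using amplitude_pos[OF a x] .
    then show "w x = a x * exp (\<beta> x)"
      using u(1)[OF x] x by (simp add: w_def \<beta>_def exp_diff exp_minus field_simps)
  qed
  also have "\<dots> = (\<Sum>x\<in>T. (a x)\<^sup>2 * \<rho>)"
  proof (intro sum.cong refl)
    fix x assume x: "x \<in> T"
    have "(\<Sum>y\<in>T. L p V x y * w y) = \<rho> * w x"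
      using u(2)[OF x] by (simp add: w_def mult.assoc[symmetric] sum_distrib_right[symmetric])
    then show "(a x)\<^sup>2 * ((\<Sum>y\<in>T. L p V x y * w y) / w x) = (a x)\<^sup>2 * \<rho>"
      using u(1)[OF x] by (simp add: w_def)
  qed
  also have "\<dots> = \<rho>"
    using a by (simp add: amplitudes_def sum_distrib_right[symmetric])
  finally show ?thesis using \<beta> unfolding \<rho>_def by blast
qed

text \<open>The maximizer comes from the normalized product of the two eigenvectors; for this weight
  the Donsker--Varadhan inequality applies to every trial vector
  \<open>a x * exp (\<beta> x)\<close>.\<close>

lemma optimal_amplitude:
  obtains a where "a \<in> amplitudes m N" "\<And>\<beta>. principal_eigenvalue m N c p V \<le> energy p V a \<beta>"
proof -
  define \<rho> where "\<rho> = principal_eigenvalue m N c p V"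
  obtain u v where u: "\<And>x. x \<in> T \<Longrightarrow> u x > 0"
      "\<And>x. x \<in> T \<Longrightarrow> (\<Sum>y\<in>T. L p V x y * u y) = \<rho> * u x"
    and v: "\<And>x. x \<in> T \<Longrightarrow> v x > 0"
      "\<And>y. y \<in> T \<Longrightarrow> (\<Sum>x\<in>T. v x * L p V x y) = \<rho> * v y"
    using principal_eigenvectors[of p V] unfolding \<rho>_def by blast
  define Z where "Z = (\<Sum>x\<in>T. u x * v x)"
  have Z: "Z > 0" unfolding Z_def using u v finite_torus torus_nonempty by (intro sum_pos) auto
  define a where "a = (\<lambda>x\<in>T. sqrt (u x * v x / Z))"
  have a2: "(a x)\<^sup>2 = u x * v x / Z" if "x \<in> T" for x
    using that u(1)[OF that] v(1)[OF that] Z by (simp add: a_def)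
  have apos: "a x > 0" if "x \<in> T" for x
    using that u(1)[OF that] v(1)[OF that] Z by (simp add: a_def)
  have "a \<in> amplitudes m N"
    using apos a2 Z by (auto simp: amplitudes_def a_def sum_divide_distrib[symmetric] Z_def[symmetric])
  moreover have "\<rho> \<le> energy p V a \<beta>" for \<beta>
  proof -
    define w where "w x = a x * exp (\<beta> x)" for x
    have "\<rho> * Z \<le> (\<Sum>x\<in>T. u x * v x * ((\<Sum>y\<in>T. L p V x y * w y) / w x))"
      unfolding Z_def
      by (rule donsker_varadhan_lower[OF op_matrix_metzler u v]) (use apos in \<open>auto simp: w_def\<close>)
    also have "\<dots> = Z * (\<Sum>x\<in>T. (a x)\<^sup>2 * ((\<Sum>y\<in>T. L p V x y * w y) / w x))"
      unfolding sum_distrib_left[of Z]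
      using Z a2 by (intro sum.cong) auto
    also have "(\<Sum>x\<in>T. (a x)\<^sup>2 * ((\<Sum>y\<in>T. L p V x y * w y) / w x)) = energy p V a \<beta>"
      by (rule energy_eq[symmetric]) (simp_all add: apos w_def)
    finally show ?thesis using Z by (simp add: mult.commute)
  qed
  ultimately show ?thesis unfolding \<rho>_def by (rule that)
qed

text \<open>For every \<open>a\<close> the eigenvector field is a competitor in the minimum, which
  gives the upper bound. At the optimal amplitude all fields, hence also the minimizing one, stay
  above the eigenvalue.\<close>

lemma principal_eigenvalue_is_maximum:
  "is_maximum (principal_eigenvalue m N c p V)
     ((\<lambda>a. - dirichlet_form m N c a + (\<Sum>x\<in>T. V x * (a x)\<^sup>2) + min_cost m N c p a)
        ` amplitudes m N)"
proof -
  let ?f = "\<lambda>a. - dirichlet_form m N c a + (\<Sum>x\<in>T. V x * (a x)\<^sup>2) + min_cost m N c p a"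
  have upper: "?f a \<le> principal_eigenvalue m N c p V" if a: "a \<in> amplitudes m N" for a
  proof -
    obtain \<beta> where "\<beta> \<in> zero_sum_fields m N" "energy p V a \<beta> = principal_eigenvalue m N c p V"
      using energy_eq_principal_eigenvalue[OF a] by blast
    then show ?thesis
      using min_cost_is_minimum[OF a, of p] by (force simp: is_minimum_def energy_def)
  qed
  obtain a where a: "a \<in> amplitudes m N" "\<And>\<beta>. principal_eigenvalue m N c p V \<le> energy p V a \<beta>"
    using optimal_amplitude by blast
  then have "principal_eigenvalue m N c p V \<le> ?f a"
    using min_cost_is_minimum[OF a(1), of p] by (auto simp: is_minimum_def energy_def)
  with upper[OF a(1)] have "principal_eigenvalue m N c p V = ?f a" by simp
  then show ?thesis using upper a(1) unfolding is_maximum_def by blast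
qed

end

theorem corollary1p3:
  fixes m :: nat and N :: "nat \<Rightarrow> nat"
    and c :: "site \<Rightarrow> nat \<Rightarrow> real" and p :: "nat \<Rightarrow> real" and V :: "site \<Rightarrow> real"
  assumes "m \<ge> 1"
    and "\<And>\<nu>. \<nu> \<in> {1..m} \<Longrightarrow> N \<nu> \<ge> 3"
    and "\<And>x \<nu>. x \<in> torus m N \<Longrightarrow> \<nu> \<in> {1..m} \<Longrightarrow> c x \<nu> > 0"
  shows "(\<forall>a\<in>amplitudes m N.
            is_minimum (min_cost m N c p a) (tilt_cost m N c p a ` zero_sum_fields m N))
       \<and> is_maximum (principal_eigenvalue m N c p V)
            ((\<lambda>a. - dirichlet_form m N c a + (\<Sum>x\<in>torus m N. V x * (a x)\<^sup>2) + min_cost m N c p a)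
               ` amplitudes m N)
       \<and> (\<forall>a\<in>amplitudes m N. min_cost m N c (\<lambda>_. 0) a = 0)
       \<and> is_maximum (principal_eigenvalue m N c (\<lambda>_. 0) V)
            ((\<lambda>a. - dirichlet_form m N c a + (\<Sum>x\<in>torus m N. V x * (a x)\<^sup>2))
               ` amplitudes m N)"
proof -
  interpret conductances m N c
    using assms by unfold_locales fastforce+
  \<comment> \<open>The minimal cost is known to vanish on amplitudes only, so it is rewritten under
    the membership assumption of the image.\<close>
  have "is_maximum (principal_eigenvalue m N c (\<lambda>_. 0) V)
      ((\<lambda>a. - dirichlet_form m N c a + (\<Sum>x\<in>torus m N. V x * (a x)\<^sup>2)) ` amplitudes m N)"
    using principal_eigenvalue_is_maximum[of "\<lambda>_. 0" V]
    by (simp add: min_cost_zero_tilt cong: image_cong_simp)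
  then show ?thesis
    using min_cost_is_minimum principal_eigenvalue_is_maximum min_cost_zero_tilt by blast
qed

end
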